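(* Let $D$ be a unique factorization domain, let $n \in D$, let $\langle n \rangle$ be the principal ideal of $D$ generated by $n$, and let $\phi : D \to D/\langle n \rangle$ be the canonical homomorphism. Then for all $a \in D$, $[\phi(a)] = [\phi(\gcd(a,n))]$.
   Context: For a commutative ring $R$ and $r \in R$, $\mathrm{ann}(r) = \{x \in R : rx = 0\}$. Write $r \sim s$ if $\mathrm{ann}(r) = \mathrm{ann}(s)$, and let $[r]$ denote the equivalence class of $r \in R$; here the classes are taken in $R = D/\langle n \rangle$. The element $\gcd(a,n)$ denotes any greatest common divisor of $a$ and $n$ in $D$ (it is determined up to associates, and the class $[\phi(\gcd(a,n))]$ does not depend on the choice). *)

theory Defs
  imports "HOL-Algebra.Algebra"
begin

definition annihilator :: "('a, 'b) ring_scheme \<Rightarrow> 'a \<Rightarrow> 'a set"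
  where "annihilator R r = {x \<in> carrier R. r \<otimes>\<^bsub>R\<^esub> x = \<zero>\<^bsub>R\<^esub>}"

definition ann_rel :: "('a, 'b) ring_scheme \<Rightarrow> ('a \<times> 'a) set"
  where "ann_rel R =
    {(r, s). r \<in> carrier R \<and> s \<in> carrier R \<and> annihilator R r = annihilator R s}"

definition ann_class :: "('a, 'b) ring_scheme \<Rightarrow> 'a \<Rightarrow> 'a set"
  where "ann_class R r = ann_rel R `` {r}"

lemma equiv_ann_rel: "equiv (carrier R) (ann_rel R)"
  by (rule equivI) (auto simp: ann_rel_def refl_on_def sym_def trans_def)

definition canonical_hom :: "('a, 'b) ring_scheme \<Rightarrow> 'a set \<Rightarrow> 'a \<Rightarrow> 'a set"
  where "canonical_hom R I a = I +>\<^bsub>R\<^esub> a"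

(* Divisibility is taken in the multiplicative monoid of the whole ring, zero included, so that
   gcds with zero make sense; the library's factorial domains only speak about nonzero elements. *)
lemma (in factorial_domain) ring_gcd_exists:
  assumes a: "a \<in> carrier R" and b: "b \<in> carrier R"
  shows "\<exists>g\<in>carrier R. g gcdof\<^bsub>R\<^esub> a b"
proof -
  have dvd0: "x divides\<^bsub>R\<^esub> \<zero>" if "x \<in> carrier R" for x
    using that unfolding factor_def by (intro bexI[of _ "\<zero>"]) simp_all
  have dvd_refl: "x divides\<^bsub>R\<^esub> x" if "x \<in> carrier R" for x
    using that unfolding factor_def by (intro bexI[of _ "\<one>"]) simp_all
  consider "a = \<zero>" | "b = \<zero>" | "a \<noteq> \<zero>" "b \<noteq> \<zero>" by blast
  then show ?thesis
  proof cases
    case 1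
    then show ?thesis using b dvd0 dvd_refl unfolding isgcd_def by blast
  next
    case 2
    then show ?thesis using a dvd0 dvd_refl unfolding isgcd_def by blast
  next
    case 3
    have am: "a \<in> carrier (mult_of R)" and bm: "b \<in> carrier (mult_of R)"
      using a b 3 by auto
    obtain g where g: "g \<in> carrier (mult_of R)" "g gcdof\<^bsub>mult_of R\<^esub> a b"
      using factorial_monoid.gcdof_exists[OF factorial_monoid_axioms am bm] by blast
    have iff: "x divides\<^bsub>mult_of R\<^esub> y \<longleftrightarrow> x divides\<^bsub>R\<^esub> y"
      if "x \<in> carrier R" "y \<in> carrier R" "y \<noteq> \<zero>" for x y
      using that r_null unfolding factor_def by (auto 0 3)
    have nz: "x \<noteq> \<zero>" if "x divides\<^bsub>R\<^esub> a" for x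
      using that 3(1) l_null unfolding factor_def by blast
    have gR: "g \<in> carrier R" using g(1) by auto
    have "g divides\<^bsub>R\<^esub> a" "g divides\<^bsub>R\<^esub> b"
      using g(2) iff[OF gR a 3(1)] iff[OF gR b 3(2)] unfolding isgcd_def by blast+
    moreover have "y divides\<^bsub>R\<^esub> g"
      if y: "y \<in> carrier R" "y divides\<^bsub>R\<^esub> a" "y divides\<^bsub>R\<^esub> b" for y
    proof -
      have ym: "y \<in> carrier (mult_of R)" using y(1) nz[OF y(2)] by simp
      have "y divides\<^bsub>mult_of R\<^esub> a" "y divides\<^bsub>mult_of R\<^esub> b"
        using y iff[OF y(1) a 3(1)] iff[OF y(1) b 3(2)] by blast+
      then have "y divides\<^bsub>mult_of R\<^esub> g"
        using g(2) ym unfolding isgcd_def by blast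
      moreover have "g \<noteq> \<zero>" using g(1) by simp
      ultimately show ?thesis using iff[OF y(1) gR] by blast
    qed
    ultimately have "g gcdof\<^bsub>R\<^esub> a b"
      unfolding isgcd_def by blast
    then show ?thesis using gR by blast
  qed
qed

end

theory Submission
  imports Defs
begin

text \<open>
  The coset of x annihilates the coset of a iff n divides a x, so it suffices to see that n divides
  a x iff n divides g x. For the nontrivial direction, let d be a gcd of x a and x n, which n divides.
  If x is nonzero, then d = x e since x divides d; cancelling x, e is a common divisor
  of a and n, so e divides g and hence d, and with it n, divides x g.
\<close>

context factorial_domain
begin

text \<open>Multiplication by \<open>x\<close> preserves gcds in a domain where gcds exist; this is
  the direction that is not formal. Allowing any common divisor \<open>m\<close> keeps it
  independent of the ideal.\<close>

lemma dvd_mult_ring_gcd: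
  assumes carr: "a \<in> carrier R" "n \<in> carrier R" "x \<in> carrier R" "m \<in> carrier R" "g \<in> carrier R"
    and g: "g gcdof\<^bsub>R\<^esub> a n"
    and m: "m divides\<^bsub>R\<^esub> x \<otimes> a" "m divides\<^bsub>R\<^esub> x \<otimes> n"
  shows "m divides\<^bsub>R\<^esub> x \<otimes> g"
\<comment> \<open>Cancellation of \<open>x\<close> fails for zero, but then the product is zero,
  which \<open>m\<close> divides with cofactor zero.\<close>
proof (cases "x = \<zero>")
  case True
  then show ?thesis
    using carr unfolding factor_def by (intro bexI[of _ "\<zero>"]) simp_all
next
  case False
  obtain d where d: "d \<in> carrier R" "d gcdof\<^bsub>R\<^esub> (x \<otimes> a) (x \<otimes> n)"
    using ring_gcd_exists[of "x \<otimes> a" "x \<otimes> n"] carr by auto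
  have "x divides\<^bsub>R\<^esub> d"
    using d(2) carr unfolding isgcd_def by (auto intro: dividesI)
  then obtain e where e: "e \<in> carrier R" "d = x \<otimes> e"
    unfolding factor_def by blast
  \<comment> \<open>Kept general in \<open>y\<close> since it serves for both \<open>a\<close> and
    \<open>n\<close>, making \<open>e\<close> a common divisor of them.\<close>
  have cancel: "e divides\<^bsub>R\<^esub> y" if y: "y \<in> carrier R" "d divides\<^bsub>R\<^esub> x \<otimes> y" for y
  proof -
    obtain c where c: "c \<in> carrier R" "x \<otimes> y = d \<otimes> c"
      using y(2) unfolding factor_def by blast
    then have "x \<otimes> y = x \<otimes> (e \<otimes> c)"
      using e carr by (simp add: m_assoc)
    then have "y = e \<otimes> c"
      using m_lcancel[OF False] carr e(1) c(1) y(1) by simp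
    then show ?thesis
      using c(1) by (auto intro: dividesI)
  qed
  have "e divides\<^bsub>R\<^esub> g"
    using g e(1) cancel[OF carr(1)] cancel[OF carr(2)] d(2) unfolding isgcd_def by simp
  then have "d divides\<^bsub>R\<^esub> x \<otimes> g"
    unfolding e(2) using e(1) carr by (simp add: divides_mult_lI)
  moreover have "m divides\<^bsub>R\<^esub> d"
    using d(2) m carr(4) unfolding isgcd_def by blast
  ultimately show ?thesis
    by (meson divides_trans carr(4))
qed

lemma dvd_mult_ring_gcd_iff:
  assumes carr: "a \<in> carrier R" "n \<in> carrier R" "g \<in> carrier R" "x \<in> carrier R"
    and g: "g gcdof\<^bsub>R\<^esub> a n"
  shows "n divides\<^bsub>R\<^esub> a \<otimes> x \<longleftrightarrow> n divides\<^bsub>R\<^esub> g \<otimes> x"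
proof
  assume "n divides\<^bsub>R\<^esub> a \<otimes> x"
  \<comment> \<open>For \<open>m = n\<close> the second divisibility required by
    \<open>dvd_mult_ring_gcd\<close> is automatic.\<close>
  moreover have "n divides\<^bsub>R\<^esub> x \<otimes> n"
    using carr m_comm by (auto intro: dividesI)
  ultimately show "n divides\<^bsub>R\<^esub> g \<otimes> x"
    using dvd_mult_ring_gcd[OF carr(1,2,4,2,3) g] carr by (simp add: m_comm)
next
  assume n: "n divides\<^bsub>R\<^esub> g \<otimes> x"
  have "g divides\<^bsub>R\<^esub> a"
    using g unfolding isgcd_def by blast
  then have "x \<otimes> g divides\<^bsub>R\<^esub> x \<otimes> a"
    using carr by (simp add: divides_mult_lI)
  then have "g \<otimes> x divides\<^bsub>R\<^esub> a \<otimes> x"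
    using carr by (simp add: m_comm)
  with n show "n divides\<^bsub>R\<^esub> a \<otimes> x"
    using carr(2) by (rule divides_trans)
qed

end

lemma (in cring) mem_cgenideal_iff_divides:
  assumes "n \<in> carrier R" "y \<in> carrier R"
  shows "y \<in> PIdl n \<longleftrightarrow> n divides\<^bsub>R\<^esub> y"
  using assms m_comm unfolding cgenideal_def factor_def by blast

lemma (in ideal) coset_mult_eq_zero_iff:
  assumes "a \<in> carrier R" "x \<in> carrier R"
  shows "(I +> a) \<otimes>\<^bsub>R Quot I\<^esub> (I +> x) = \<zero>\<^bsub>R Quot I\<^esub> \<longleftrightarrow> a \<otimes> x \<in> I"
proof -
  have "(I +> a) \<otimes>\<^bsub>R Quot I\<^esub> (I +> x) = I +> a \<otimes> x"
    using assms by (simp add: FactRing_def rcoset_mult_add)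
  moreover have "\<zero>\<^bsub>R Quot I\<^esub> = I"
    by (simp add: FactRing_def)
  \<comment> \<open>A coset contains its representative, and an element of \<open>I\<close> has
    coset \<open>I\<close>.\<close>
  moreover have "I +> a \<otimes> x = I \<longleftrightarrow> a \<otimes> x \<in> I"
    using a_rcos_self[of "a \<otimes> x"] a_rcos_const[of "a \<otimes> x"] assms by (metis m_closed)
  ultimately show ?thesis by simp
qed

text \<open>Every element of the quotient is a coset, so the condition can be tested on
  representatives. Comparing annihilators in the quotient thus reduces to comparing subsets of
  \<open>R\<close>.\<close>

lemma (in ideal) annihilator_coset:
  assumes "a \<in> carrier R"
  shows "annihilator (R Quot I) (I +> a) = (\<lambda>x. I +> x) ` {x \<in> carrier R. a \<otimes> x \<in> I}"
proof -
  have "carrier (R Quot I) = (\<lambda>x. I +> x) ` carrier R"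
    by (auto simp: FactRing_def A_RCOSETS_def')
  then show ?thesis
    using coset_mult_eq_zero_iff[OF assms] unfolding annihilator_def by auto
qed

lemma ann_class_eqI:
  assumes "annihilator R r = annihilator R s" "r \<in> carrier R" "s \<in> carrier R"
  shows "ann_class R r = ann_class R s"
  using assms unfolding ann_class_def ann_rel_def by auto

lemma (in factorial_domain) ann_class_coset_gcd:
  assumes n: "n \<in> carrier R" and a: "a \<in> carrier R" and g: "g \<in> carrier R" "g gcdof\<^bsub>R\<^esub> a n"
  shows "ann_class (R Quot (PIdl n)) (PIdl n +> a) = ann_class (R Quot (PIdl n)) (PIdl n +> g)"
proof (rule ann_class_eqI)
  \<comment> \<open>Membership in \<open>PIdl n\<close> is divisibility by \<open>n\<close>, so the
    gcd equivalence shows that the same representatives \<open>x\<close> describe both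
    annihilators.\<close>
  have "a \<otimes> x \<in> PIdl n \<longleftrightarrow> g \<otimes> x \<in> PIdl n" if x: "x \<in> carrier R" for x
    using dvd_mult_ring_gcd_iff[OF a n g(1) x g(2)]
      mem_cgenideal_iff_divides[OF n m_closed[OF a x]]
      mem_cgenideal_iff_divides[OF n m_closed[OF g(1) x]]
    by simp
  then have "{x \<in> carrier R. a \<otimes> x \<in> PIdl n} = {x \<in> carrier R. g \<otimes> x \<in> PIdl n}"
    by blast
  then show "annihilator (R Quot (PIdl n)) (PIdl n +> a) = annihilator (R Quot (PIdl n)) (PIdl n +> g)"
    using ideal.annihilator_coset[OF cgenideal_ideal[OF n]] a g(1) by simp
  show "PIdl n +> a \<in> carrier (R Quot (PIdl n))" "PIdl n +> g \<in> carrier (R Quot (PIdl n))"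
    using a g(1) by (auto simp: FactRing_def A_RCOSETS_def')
qed

theorem theorem5:
  fixes D :: "('a, 'b) ring_scheme" and n :: 'a and \<phi> :: "'a \<Rightarrow> 'a set"
  assumes "factorial_domain D"
    and "n \<in> carrier D"
  defines "\<phi> \<equiv> canonical_hom D (PIdl\<^bsub>D\<^esub> n)"
  shows "\<forall>a\<in>carrier D. \<forall>g\<in>carrier D. g gcdof\<^bsub>D\<^esub> a n \<longrightarrow>
    ann_class (D Quot (PIdl\<^bsub>D\<^esub> n)) (\<phi> a) = ann_class (D Quot (PIdl\<^bsub>D\<^esub> n)) (\<phi> g)"
  using factorial_domain.ann_class_coset_gcd[OF assms(1)] assms(2)
  unfolding \<phi>_def canonical_hom_def by blast

end
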